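(* Let $q\ge 4$ be a prime power and let $f\in\mathrm{Per}(\mathbb{F}_q^2)\setminus\mathrm{A\Gamma L}(2,\mathbb{F}_q)$. Then $1\text{-coaffinity}(f)\ge 2q$.
   Context: $\mathrm{Per}(\mathbb{F}_q^2)$ is the group of permutations of $\mathbb{F}_q^2$. $\mathrm{A\Gamma L}(2,\mathbb{F}_q)$ is the group of invertible semi-affine maps of $\mathbb{F}_q^2$, i.e. maps $x\mapsto g(x)+b$ where $b\in\mathbb{F}_q^2$ and $g$ is a bijective additive map with $g(\alpha x)=\sigma(\alpha)g(x)$ for some field automorphism $\sigma$ of $\mathbb{F}_q$. A line ($1$-flat) is a coset of a $1$-dimensional subspace. $1\text{-coaffinity}(f)$ is the number of lines $L$ such that $f(L)$ is not a line. *)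

theory Defs
  imports "HOL-Analysis.Cartesian_Space"
begin

definition field_automorphism :: "('a::field \<Rightarrow> 'a) \<Rightarrow> bool" where
  "field_automorphism \<sigma> \<longleftrightarrow>
     bij \<sigma> \<and> \<sigma> 1 = 1 \<and>
     (\<forall>x y. \<sigma> (x + y) = \<sigma> x + \<sigma> y) \<and> (\<forall>x y. \<sigma> (x * y) = \<sigma> x * \<sigma> y)"

definition AGammaL :: "('a::field ^ 'n \<Rightarrow> 'a ^ 'n) set" where
  "AGammaL = {f. \<exists>g b \<sigma>.
     bij g \<and> (\<forall>x y. g (x + y) = g x + g y) \<and>
     field_automorphism \<sigma> \<and> (\<forall>\<alpha> x. g (\<alpha> *s x) = \<sigma> \<alpha> *s g x) \<and>
     f = (\<lambda>x. g x + b)}"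

definition is_line :: "('a::field ^ 'n) set \<Rightarrow> bool" where
  "is_line L \<longleftrightarrow> (\<exists>a V. vec.subspace V \<and> vec.dim V = 1 \<and> L = (\<lambda>v. a + v) ` V)"

definition one_coaffinity :: "('a::{field,finite} ^ 'n \<Rightarrow> 'a ^ 'n) \<Rightarrow> nat" where
  "one_coaffinity f = card {L. is_line L \<and> \<not> is_line (f ` L)}"

end

theory Submission
  imports Defs
begin

text \<open>
  Suppose that fewer than \<open>2q\<close> lines are bad, i.e. not mapped to lines. Good parallel lines have
  parallel images, so a parallel class cannot contain exactly one bad line; since there are
  \<open>q + 1\<close> classes, two of them are entirely good. In coordinates adapted to these two classes the
  map reads \<open>(x, y) \<mapsto> (a x, c y)\<close>. If a further class, of slope \<open>m\<close>, had exactly two bad lines, then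
  some \<open>c \<circ> (translation) \<circ> c\<^sup>-\<^sup>1\<close> would be a non-trivial translation times a transposition, which is
  impossible because all cycles of a translation have the same length. Hence every class is good
  or has at least three bad lines, and counting yields a third good class, which makes \<open>c\<close>
  additive. Now a class with one bad line is entirely bad, so at most one class is bad. The slopes
  of the good classes are closed under addition, so no class is bad, and \<open>c\<close> is a multiple of a
  field automorphism.
\<close>

subsection \<open>Lines of the affine plane\<close>

definition line_through :: "'a::field ^ 'n \<Rightarrow> 'a ^ 'n \<Rightarrow> ('a ^ 'n) set" where
  "line_through p d = range (\<lambda>t. p + t *s d)"

text \<open>A basis of a one-dimensional subspace is a single nonzero vector. This replaces the
  dimension in the definition by an explicit parametrisation, the only form used later.\<close>

lemma is_line_iff: "is_line L \<longleftrightarrow> (\<exists>p d. d \<noteq> 0 \<and> L = line_through p d)"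
proof
  assume "is_line L"
  then obtain p V where V: "vec.subspace V" "vec.dim V = 1" "L = (\<lambda>v. p + v) ` V"
    unfolding is_line_def by blast
  obtain B where B: "B \<subseteq> V" "vec.independent B" "V \<subseteq> vec.span B" "card B = vec.dim V"
    using vec.basis_exists by blast
  obtain d where d: "B = {d}" using B V card_1_singletonE by metis
  have "d \<noteq> 0" using B(2) d vec.dependent_zero by blast
  moreover have "V = vec.span {d}"
    using B V(1) d by (metis vec.span_minimal subset_antisym)
  ultimately have "d \<noteq> 0 \<and> L = line_through p d"
    using V(3) by (auto simp: line_through_def vec.span_singleton)
  then show "\<exists>p d. d \<noteq> 0 \<and> L = line_through p d" by blast
next
  assume "\<exists>p d. d \<noteq> 0 \<and> L = line_through p d"
  then obtain p d where pd: "d \<noteq> 0" "L = line_through p d" by blast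
  have "vec.dim (vec.span {d}) = card {d}"
    using pd(1) by (intro vec.dim_span_eq_card_independent) simp
  moreover have "L = (\<lambda>v. p + v) ` vec.span {d}"
    using pd(2) by (auto simp: line_through_def vec.span_singleton)
  ultimately show "is_line L" unfolding is_line_def
    by (metis vec.subspace_span card_1_singleton_iff One_nat_def)
qed

lemma mem_line_through: "p \<in> line_through p d"
  by (auto simp: line_through_def intro: image_eqI[where x = 0])

lemma line_through_eq:
  assumes "r \<in> line_through p d" shows "line_through p d = line_through r d"
proof -
  obtain s where r: "r = p + s *s d" using assms by (auto simp: line_through_def)
  have "p + t *s d = r + (t - s) *s d" "r + t *s d = p + (s + t) *s d" for t
    by (simp_all add: r algebra_simps vec.scale_left_distrib vec.scale_left_diff_distrib)
  then show ?thesis unfolding line_through_def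
    by (metis (mono_tags, lifting) image_subset_iff subset_antisym rangeI)
qed

lemma line_through_disjoint_or_eq:
  "line_through p d = line_through r d \<or> line_through p d \<inter> line_through r d = {}"
  using line_through_eq by blast

lemma line_through_scale:
  assumes "k \<noteq> 0" shows "line_through p (k *s d) = line_through p d"
proof -
  have "p + t *s d = p + (t / k) *s (k *s d)" "p + t *s (k *s d) = p + (t * k) *s d" for t
    using assms by simp_all
  then show ?thesis unfolding line_through_def
    by (metis (mono_tags, lifting) image_subset_iff subset_antisym rangeI)
qed

lemma card_line_through:
  fixes d :: "'a::{field,finite} ^ 'n"
  assumes "d \<noteq> 0" shows "card (line_through p d) = CARD('a)"
  unfolding line_through_def using assms
  by (intro card_image) (auto intro!: injI)

text \<open>The 2x2 determinant with columns \<open>u\<close> and \<open>v\<close>, serving as a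
  test for linear independence.\<close>

definition cross2 :: "'a::field ^ 2 \<Rightarrow> 'a ^ 2 \<Rightarrow> 'a" where
  "cross2 u v = u $ 1 * v $ 2 - u $ 2 * v $ 1"

text \<open>Cramer's rule in the basis \<open>d\<close>, \<open>e\<close>.\<close>

lemma cross2_decomp:
  assumes "cross2 d e \<noteq> 0"
  shows "v = (cross2 v e / cross2 d e) *s d + (cross2 d v / cross2 d e) *s e"
proof -
  have "cross2 d e * v $ i = cross2 v e * d $ i + cross2 d v * e $ i" if "i = 1 \<or> i = 2" for i
    using that by (auto simp: cross2_def algebra_simps)
  then have "cross2 d e * v $ i = cross2 v e * d $ i + cross2 d v * e $ i" for i
    using exhaust_2 by blast
  then show ?thesis using assms
    by (simp add: vec_eq_iff field_simps)
qed

lemma cross2_unique: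
  assumes "cross2 d e \<noteq> 0" "x *s d + y *s e = x' *s d + y' *s e"
  shows "x = x' \<and> y = y'"
proof -
  have "cross2 (x *s d + y *s e) e = x * cross2 d e" "cross2 d (x *s d + y *s e) = y * cross2 d e" for x y
    by (simp_all add: cross2_def algebra_simps)
  then show ?thesis using assms by (metis mult_right_cancel)
qed

lemma cross2_eq_0D:
  assumes "cross2 d e = 0" "d \<noteq> 0" "e \<noteq> 0"
  obtains k where "k \<noteq> 0" "e = k *s d"
proof -
  have eq: "d $ 1 * e $ 2 = d $ 2 * e $ 1" using assms(1) by (simp add: cross2_def)
  obtain k where k: "e = k *s d"
  proof (cases "d $ 1 = 0")
    case True
    then have "d $ 2 \<noteq> 0" using assms(2) by (auto simp: vec_eq_iff forall_2)
    then have "e = (e $ 2 / d $ 2) *s d" using eq True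
      by (auto simp: vec_eq_iff forall_2)
    then show ?thesis using that by blast
  next
    case False
    then have "e = (e $ 1 / d $ 1) *s d" using eq
      by (auto simp: vec_eq_iff forall_2 field_simps)
    then show ?thesis using that by blast
  qed
  then show ?thesis using that assms(3) by fastforce
qed

text \<open>If the directions were independent, Cramer's rule applied to \<open>r - p\<close> would
  produce a common point.\<close>

lemma disjoint_lines_parallel:
  fixes p :: "'a::field ^ 2"
  assumes "line_through p d \<inter> line_through r e = {}" "d \<noteq> 0" "e \<noteq> 0"
  shows "line_through s e = line_through s d"
proof (cases "cross2 d e = 0")
  case True
  then show ?thesis using assms cross2_eq_0D line_through_scale by metis
next
  case False
  define x y where "x = cross2 (r - p) e / cross2 d e" and "y = cross2 d (r - p) / cross2 d e"
  have "r - p = x *s d + y *s e"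
    unfolding x_def y_def by (rule cross2_decomp[OF False])
  then have "p + x *s d = r + (- y) *s e"
    by (simp add: algebra_simps vec.scale_minus_left)
  then have "p + x *s d \<in> line_through p d \<inter> line_through r e"
    unfolding line_through_def by (metis IntI rangeI)
  then show ?thesis using assms(1) by blast
qed

subsection \<open>Parallel classes\<close>

text \<open>The directions \<open>(1, m)\<close> and \<open>(0, 1)\<close> represent each parallel class exactly once.\<close>

definition directions :: "('a::field ^ 2) set" where
  "directions = insert (vector [0, 1]) (range (\<lambda>m. vector [1, m]))"

lemma card_directions: "card (directions :: ('a::{field,finite} ^ 2) set) = CARD('a) + 1"
proof -
  have "inj (\<lambda>m::'a. vector [1, m] :: 'a ^ 2)"
    by (rule injI) (simp add: vec_eq_iff forall_2)
  moreover have "vector [0, 1] \<notin> range (\<lambda>m::'a. vector [1, m] :: 'a ^ 2)"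
    by (auto simp: vec_eq_iff forall_2)
  ultimately show ?thesis by (simp add: directions_def card_image)
qed

lemma directions_nonzero: "d \<in> directions \<Longrightarrow> d \<noteq> 0"
  by (auto simp: directions_def vec_eq_iff forall_2)

lemma directions_cross2: "d \<in> directions \<Longrightarrow> e \<in> directions \<Longrightarrow> d \<noteq> e \<Longrightarrow> cross2 d e \<noteq> 0"
  by (auto simp: directions_def cross2_def)

lemma line_through_direction_unique:
  fixes d :: "'a::field ^ 2"
  assumes "line_through p d = line_through r e" "d \<noteq> 0"
  shows "cross2 d e = 0"
proof (rule ccontr)
  assume c: "cross2 d e \<noteq> 0"
  have "p \<in> line_through r e" using assms(1) mem_line_through by blast
  then have "line_through p d = line_through p e" using assms(1) line_through_eq by blast
  moreover have "p + 1 *s d \<in> line_through p d" unfolding line_through_def by blast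
  ultimately have "p + 1 *s d \<in> line_through p e" by simp
  then obtain t where "p + 1 *s d = p + t *s e" unfolding line_through_def by blast
  then have "1 *s d + 0 *s e = 0 *s d + t *s e" by simp
  then show False using cross2_unique[OF c] zero_neq_one by metis
qed

text \<open>Injectivity keeps images of parallel lines disjoint, so all images of good lines share
  one direction \<open>e\<close>. The line through \<open>p0\<close> is allowed to be bad: its image
  is what the other images leave over, hence again a line. So no class has exactly one bad
  line.\<close>

lemma parallel_class_image:
  fixes f :: "'a::{field,finite} ^ 2 \<Rightarrow> 'a ^ 2"
  assumes f: "bij f" and d: "d \<noteq> 0"
    and good: "\<And>p. line_through p d \<noteq> line_through p0 d \<Longrightarrow> is_line (f ` line_through p d)"
  obtains e where "e \<noteq> 0" "\<And>p. f ` line_through p d = line_through (f p) e"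
proof -
  have inj: "inj f" and surj: "surj f" using f by (auto simp: bij_def)
  \<comment> \<open>A point off the exceptional line is needed to read off \<open>e\<close>;
    \<open>d'\<close> is a vector independent of \<open>d\<close>.\<close>
  have "line_through p0 d \<noteq> UNIV"
  proof
    assume *: "line_through p0 d = UNIV"
    define d' :: "'a ^ 2" where "d' = (if d $ 1 = 0 then vector [1, 0] else vector [0, 1])"
    have c: "cross2 d d' \<noteq> 0" using d
      by (auto simp: d'_def cross2_def vec_eq_iff forall_2)
    have "p0 + d' \<in> line_through p0 d" using * by simp
    then obtain t where "p0 + d' = p0 + t *s d" unfolding line_through_def by blast
    then have "0 *s d + 1 *s d' = t *s d + 0 *s d'" by simp
    then show False using cross2_unique[OF c] zero_neq_one by metis
  qed
  then obtain p1 where p1: "p1 \<notin> line_through p0 d" by blast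
  have line: "\<exists>e. e \<noteq> 0 \<and> f ` line_through p d = line_through (f p) e"
    if "p \<notin> line_through p0 d" for p
  proof -
    have "line_through p d \<noteq> line_through p0 d" using that mem_line_through by blast
    then obtain r e where e: "e \<noteq> 0" "f ` line_through p d = line_through r e"
      using good is_line_iff by blast
    then show ?thesis using line_through_eq mem_line_through by (metis imageI)
  qed
  obtain e where e: "e \<noteq> 0" "f ` line_through p1 d = line_through (f p1) e"
    using line p1 by blast
  have off: "f ` line_through p d = line_through (f p) e" if p: "p \<notin> line_through p0 d" for p
  proof -
    obtain e' where e': "e' \<noteq> 0" "f ` line_through p d = line_through (f p) e'"
      using line p by blast
    show ?thesis
    proof (cases "line_through p d = line_through p1 d")
      case True
      then show ?thesis using e(2) line_through_eq mem_line_through by (metis imageI)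
    next
      case False
      then have "line_through p d \<inter> line_through p1 d = {}"
        using line_through_disjoint_or_eq by blast
      then have "line_through (f p1) e \<inter> line_through (f p) e' = {}"
        using e(2) e'(2) inj by (metis Int_commute image_Int image_empty)
      then show ?thesis using disjoint_lines_parallel e(1) e' by metis
    qed
  qed
  have on: "f ` line_through p d = line_through (f p) e" if p: "p \<in> line_through p0 d" for p
  proof -
    have eq: "line_through p d = line_through p0 d" using line_through_eq p by blast
    \<comment> \<open>By cardinality one inclusion suffices. A preimage \<open>s\<close> off the
      exceptional line would have a line whose image is the whole target line, including
      \<open>f p\<close>, so that line would contain \<open>p\<close>.\<close>
    have "line_through (f p) e \<subseteq> f ` line_through p d"
    proof
      fix z assume z: "z \<in> line_through (f p) e"
      obtain s where s: "z = f s" using surj by blast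
      have "s \<in> line_through p d"
      proof (rule ccontr)
        assume ns: "s \<notin> line_through p d"
        then have "f ` line_through s d = line_through (f s) e" using off eq by blast
        also have "\<dots> = line_through (f p) e" using line_through_eq z s by blast
        finally have "p \<in> line_through s d"
          using mem_line_through inj by (metis inj_image_mem_iff)
        then show False using ns line_through_eq mem_line_through by blast
      qed
      then show "z \<in> f ` line_through p d" using s by blast
    qed
    moreover have "card (f ` line_through p d) = CARD('a)"
      using card_image[OF inj_on_subset[OF inj]] card_line_through[OF d] by (metis subset_UNIV)
    ultimately show ?thesis using card_line_through[OF e(1)] by (metis card_subset_eq finite)
  qed
  show thesis using that e(1) on off by blast
qed

lemma two_good_directions:
  fixes f :: "'a::{field,finite} ^ 2 \<Rightarrow> 'a ^ 2"
  assumes f: "bij f" and few: "one_coaffinity f < 2 * CARD('a)"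
  obtains d1 d2 where "cross2 d1 d2 \<noteq> 0"
    "\<And>p. is_line (f ` line_through p d1)" "\<And>p. is_line (f ` line_through p d2)"
proof -
  \<comment> \<open>\<open>B d\<close> collects the bad lines of one class, \<open>D\<close> the
    directions whose class has any.\<close>
  define B where "B d = {L. \<exists>p. L = line_through p d \<and> \<not> is_line (f ` L)}" for d
  define D where "D = {d \<in> directions. B d \<noteq> {}}"
  have two: "2 \<le> card (B d)" if d: "d \<in> D" for d
  proof (rule ccontr)
    assume "\<not> 2 \<le> card (B d)"
    moreover have "card (B d) \<noteq> 0" using d by (simp add: D_def)
    ultimately have "card (B d) = 1" by linarith
    then obtain L where L: "B d = {L}" using card_1_singletonE by blast
    then have "L \<in> B d" by simp
    then obtain p0 where p0: "L = line_through p0 d" "\<not> is_line (f ` line_through p0 d)"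
      unfolding B_def by blast
    have d0: "d \<noteq> 0" using d directions_nonzero by (auto simp: D_def)
    have "is_line (f ` line_through p d)" if "line_through p d \<noteq> line_through p0 d" for p
      using that L p0 by (auto simp: B_def)
    then obtain e where "e \<noteq> 0" "\<And>p. f ` line_through p d = line_through (f p) e"
      using parallel_class_image[OF f d0] by metis
    then have "is_line (f ` line_through p0 d)" unfolding is_line_iff by blast
    then show False using p0(2) by blast
  qed
  have disj: "B d \<inter> B e = {}" if "d \<in> D" "e \<in> D" "d \<noteq> e" for d e
  proof -
    have "d \<in> directions" "e \<in> directions" using that by (simp_all add: D_def)
    then have "cross2 d e \<noteq> 0" "d \<noteq> 0"
      using directions_cross2 directions_nonzero that(3) by metis+
    then have "line_through p d \<noteq> line_through r e" for p r
      using line_through_direction_unique by blast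
    then show ?thesis unfolding B_def by blast
  qed
  have "(\<Union>d\<in>D. B d) \<subseteq> {L. is_line L \<and> \<not> is_line (f ` L)}"
  proof
    fix L assume "L \<in> (\<Union>d\<in>D. B d)"
    then obtain d p where dp: "d \<in> directions" "L = line_through p d" "\<not> is_line (f ` L)"
      unfolding B_def D_def by blast
    then have "is_line L" unfolding is_line_iff using directions_nonzero by blast
    then show "L \<in> {L. is_line L \<and> \<not> is_line (f ` L)}" using dp by blast
  qed
  then have "card (\<Union>d\<in>D. B d) \<le> one_coaffinity f"
    unfolding one_coaffinity_def by (intro card_mono) auto
  moreover have "card (\<Union>d\<in>D. B d) = (\<Sum>d\<in>D. card (B d))"
    using disj by (intro card_UN_disjoint) auto
  moreover have "(\<Sum>d\<in>D. card (B d)) \<ge> (\<Sum>d\<in>D. 2)"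
    using two by (intro sum_mono) auto
  \<comment> \<open>Twice \<open>card D\<close> is below \<open>2 * CARD('a)\<close>, so at least
    two of the q + 1 directions lie outside \<open>D\<close>.\<close>
  ultimately have "card D < CARD('a)" using few by simp
  moreover have "card (directions - D) = card (directions :: ('a ^ 2) set) - card D"
    by (intro card_Diff_subset) (auto simp: D_def)
  ultimately have "2 \<le> card (directions - D)" using card_directions[where 'a = 'a] by simp
  then obtain T where "T \<subseteq> directions - D" "card T = 2"
    using obtain_subset_with_card_n by metis
  then obtain d1 d2 where "d1 \<in> directions - D" "d2 \<in> directions - D" and ne: "d1 \<noteq> d2"
    by (metis card_2_iff insert_subset)
  then have d12: "d1 \<in> directions" "d2 \<in> directions" "B d1 = {}" "B d2 = {}"
    by (auto simp: D_def)
  show thesis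
  proof (rule that)
    show "cross2 d1 d2 \<noteq> 0" using d12 ne directions_cross2 by metis
    show "is_line (f ` line_through p d1)" "is_line (f ` line_through p d2)" for p
      using d12(3,4) unfolding B_def by blast+
  qed
qed

subsection \<open>Maps acting separately on two coordinates\<close>

text \<open>The map \<open>(x, y) \<mapsto> (a x, c y)\<close>, with \<open>a 0 = 0\<close>, sends the line \<open>y = m x + b\<close> to a line.\<close>

definition good_line :: "('a::field \<Rightarrow> 'a) \<Rightarrow> ('a \<Rightarrow> 'a) \<Rightarrow> 'a \<Rightarrow> 'a \<Rightarrow> bool" where
  "good_line a c m b \<longleftrightarrow> (\<exists>m'. \<forall>x. c (m * x + b) = m' * a x + c b)"

text \<open>Following the cycle of \<open>b1\<close> under translation by \<open>v\<close> until it first returns to \<open>{b1, b2}\<close>.\<close>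

lemma translation_not_conj_translation_transposition:
  fixes c :: "'a::{field,finite} \<Rightarrow> 'a"
  assumes c: "inj c" and v: "v \<noteq> 0" and u: "u \<noteq> 0" and b: "b1 \<noteq> b2"
    and off: "\<And>y. y \<noteq> b1 \<Longrightarrow> y \<noteq> b2 \<Longrightarrow> c (y + v) = u + c y"
    and at: "c (b1 + v) = u + c b2"
  shows False
proof -
  define P where "P k \<longleftrightarrow> k \<ge> 1 \<and> (b1 + of_nat k * v = b1 \<or> b1 + of_nat k * v = b2)" for k :: nat
  \<comment> \<open>A return time exists: after characteristic many steps the translation is back at
    \<open>b1\<close>.\<close>
  have "P CHAR('a)"
    using finite_imp_CHAR_pos[where 'a = 'a] by (simp add: P_def)
  then have k: "P (LEAST k. P k)" by (rule LeastI)
  define k where "k = (LEAST k. P k)"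
  have min: "\<not> P j" if "j < k" for j using that not_less_Least unfolding k_def by blast
  \<comment> \<open>The first step starts at \<open>b1\<close> and uses \<open>at\<close>, which
    replaces \<open>c b1\<close> by \<open>c b2\<close>; all later steps before time
    \<open>k\<close> start outside \<open>{b1, b2}\<close> and use \<open>off\<close>.\<close>
  have iter: "c (b1 + of_nat (Suc j) * v) = c b2 + of_nat (Suc j) * u" if "Suc j \<le> k" for j
    using that
  proof (induction j)
    case 0
    then show ?case using at by (simp add: add.commute)
  next
    case (Suc j)
    have "\<not> P (Suc j)" using min Suc.prems by simp
    then have "c (b1 + of_nat (Suc j) * v + v) = u + c (b1 + of_nat (Suc j) * v)"
      using off by (auto simp: P_def)
    then show ?case using Suc by (simp add: algebra_simps)
  qed
  have k1: "k \<ge> 1" and kb: "b1 + of_nat k * v = b1 \<or> b1 + of_nat k * v = b2"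
    using k by (simp_all add: P_def k_def)
  have ck: "c (b1 + of_nat k * v) = c b2 + of_nat k * u"
    using iter[of "k - 1"] k1 by simp
  \<comment> \<open>A return to \<open>b1\<close> gives \<open>c b1 = c b2\<close>; a return to
    \<open>b2\<close> gives \<open>of_nat k * u = 0\<close> with both factors nonzero.\<close>
  show False
  proof (cases "of_nat k = (0::'a)")
    case True
    then show False using ck b c by (simp add: inj_eq)
  next
    case False
    then have "b1 + of_nat k * v = b2" using kb v by simp
    then show False using ck False u by simp
  qed
qed

text \<open>Good intercepts share one image slope \<open>m'\<close>. For the at most two others,
  bijectivity of \<open>c\<close> leaves only the exchange of their values, which the previous lemma
  excludes.\<close>

lemma slope_good_if_at_most_two_bad:
  fixes a c :: "'a::{field,finite} \<Rightarrow> 'a"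
  assumes a: "bij a" "a 0 = 0" and c: "bij c" and q: "CARD('a) \<ge> 3" and m: "m \<noteq> 0"
    and bad: "card {b. \<not> good_line a c m b} \<le> 2"
  obtains m' where "m' \<noteq> 0" "\<And>b x. c (m * x + b) = m' * a x + c b"
proof -
  have inja: "inj a" and injc: "inj c" and surjc: "surj c" and surja: "surj a"
    using a c by (auto simp: bij_def)
  have "\<exists>b1 b2. {b. \<not> good_line a c m b} \<subseteq> {b1, b2}"
  proof -
    consider "card {b. \<not> good_line a c m b} = 0" | "card {b. \<not> good_line a c m b} = 1"
      | "card {b. \<not> good_line a c m b} = 2" using bad by linarith
    then show ?thesis
    proof cases
      case 1 then show ?thesis by simp
    next
      case 2 then show ?thesis by (metis card_1_singletonE insertI1 singletonD subsetI)
    next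
      case 3 then show ?thesis by (metis card_2_iff order_refl)
    qed
  qed
  then obtain b1 b2 where b12: "\<And>b. b \<noteq> b1 \<Longrightarrow> b \<noteq> b2 \<Longrightarrow> good_line a c m b" by blast
  have "card {b1, b2} \<le> 2" by (simp add: card_insert_if)
  then have "{b1, b2} \<noteq> UNIV" using q by (metis not_less_eq_eq numeral_2_eq_2 numeral_3_eq_3 le_trans)
  then obtain b0 where b0: "b0 \<noteq> b1" "b0 \<noteq> b2" by blast
  obtain m' where m': "\<And>x. c (m * x + b0) = m' * a x + c b0"
    using b12[OF b0] by (auto simp: good_line_def)
  have m'0: "m' \<noteq> 0"
  proof
    assume "m' = 0"
    then have "c (m * 1 + b0) = c b0" using m'[of 1] by simp
    then show False using injc m by (simp add: inj_eq)
  qed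
  have off: "c (m * x + b) = m' * a x + c b" if b: "b \<noteq> b1" "b \<noteq> b2" for b x
  proof -
    obtain n where n: "\<And>x. c (m * x + b) = n * a x + c b"
      using b12[OF b] by (auto simp: good_line_def)
    \<comment> \<open>Image lines of different slopes would meet, at the \<open>x\<close> chosen
      below, although the original lines are parallel.\<close>
    have "n = m'"
    proof (rule ccontr)
      assume ne: "n \<noteq> m'"
      obtain x where x: "a x = (c b0 - c b) / (n - m')" using surja by (metis surjD)
      have "(n - m') * a x = c b0 - c b" using ne by (simp add: x)
      then have "n * a x + c b = m' * a x + c b0" by (simp add: algebra_simps)
      then have "c (m * x + b) = c (m * x + b0)" using n m' by simp
      then have "b = b0" using injc by (simp add: inj_eq)
      then have "n * a 1 = m' * a 1" using n m' by (metis add_right_cancel)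
      moreover have "a 1 \<noteq> 0" using inja a(2) by (metis injD zero_neq_one)
      ultimately show False using ne by simp
    qed
    then show ?thesis using n by simp
  qed
  have swap: "c (m * x + b) = m' * a x + c b"
    if b: "b = b1 \<and> b' = b2 \<or> b = b2 \<and> b' = b1" for b b' x
  proof (rule ccontr)
    assume ne: "c (m * x + b) \<noteq> m' * a x + c b"
    \<comment> \<open>\<open>z\<close> is the intercept whose expected value at \<open>x\<close> is
      the one actually taken by \<open>b\<close>. It is not \<open>b\<close>, and a good
      \<open>z\<close> would violate injectivity, so it is \<open>b'\<close>.\<close>
    obtain z where z: "c z = c (m * x + b) - m' * a x" using surjc by (metis surjD)
    have zb: "z \<noteq> b" using z ne by auto
    have zb': "z = b'"
    proof (rule ccontr)
      assume "z \<noteq> b'"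
      then have "c (m * x + z) = m' * a x + c z" using off zb b by blast
      then have "c (m * x + z) = c (m * x + b)" using z by simp
      then show False using injc zb by (simp add: inj_eq)
    qed
    have x: "x \<noteq> 0" using ne a(2) by auto
    have ax: "a x \<noteq> 0" using inja a(2) x by (metis injD)
    show False
    proof (rule translation_not_conj_translation_transposition[OF injc, of "m * x" "m' * a x" b b'])
      show "m * x \<noteq> 0" "m' * a x \<noteq> 0" using m x m'0 ax by auto
      show "b \<noteq> b'" using zb zb' by blast
      show "c (y + m * x) = m' * a x + c y" if "y \<noteq> b" "y \<noteq> b'" for y
        using off[of y x] that b by (auto simp: add.commute)
      show "c (b + m * x) = m' * a x + c b'" using z zb' by (simp add: add.commute)
    qed
  qed
  have "c (m * x + b) = m' * a x + c b" for b x
    using off swap by (cases "b = b1 \<or> b = b2") blast+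
  then show thesis using that m'0 by blast
qed

text \<open>One good nonzero slope makes \<open>c\<close> additive. The remaining good slopes then
  supply multiplicativity of the normalised map \<open>\<sigma>\<close>, first for all but at most
  one factor and then, by additivity, for every factor.\<close>

lemma separated_semilinear:
  fixes a c :: "'a::{field,finite} \<Rightarrow> 'a"
  assumes a: "bij a" "a 0 = 0" and c: "bij c" and q: "CARD('a) \<ge> 3"
    and few: "card {(m, b). m \<noteq> 0 \<and> \<not> good_line a c m b} < 2 * CARD('a)"
    and c0: "c 0 = 0"
  obtains \<sigma> k l where "field_automorphism \<sigma>" "\<And>x. a x = k * \<sigma> x" "\<And>x. c x = l * \<sigma> x"
proof -
  define N where "N = {(m, b). m \<noteq> 0 \<and> \<not> good_line a c m b}"
  have injc: "inj c" using c by (simp add: bij_def)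
  have "\<exists>m. m \<noteq> 0 \<and> card {b. \<not> good_line a c m b} \<le> 2"
  proof (rule ccontr)
    assume none: "\<not> ?thesis"
    have many: "3 \<le> card {b. \<not> good_line a c m b}" if "m \<noteq> 0" for m
    proof -
      have "\<not> card {b. \<not> good_line a c m b} \<le> 2" using none that by blast
      then show ?thesis by linarith
    qed
    have "N = (SIGMA m:UNIV - {0}. {b. \<not> good_line a c m b})" by (auto simp: N_def)
    then have "card N = (\<Sum>m\<in>UNIV - {0}. card {b. \<not> good_line a c m b})"
      by (simp add: card_SigmaI)
    also have "\<dots> \<ge> (\<Sum>m\<in>UNIV - {0::'a}. 3)" using many by (intro sum_mono) auto
    \<comment> \<open>From q = 3 on, 3(q - 1) is at least 2q, contradicting
      \<open>few\<close>.\<close>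
    finally have "3 * (CARD('a) - 1) \<le> card N" by (simp add: card_Diff_singleton)
    then show False using few q unfolding N_def by linarith
  qed
  then obtain m where m: "m \<noteq> 0" "card {b. \<not> good_line a c m b} \<le> 2" by blast
  obtain m' where m'0: "m' \<noteq> 0" and m': "\<And>b x. c (m * x + b) = m' * a x + c b"
    using slope_good_if_at_most_two_bad[OF a c q m] by blast
  have ca: "c (m * x) = m' * a x" for x using m'[of x 0] c0 by simp
  \<comment> \<open>Evaluating slope \<open>m\<close> at \<open>x / m\<close> turns the affine law
    into additivity.\<close>
  have add: "c (x + y) = c x + c y" for x y
    using m'[of "x / m" y] ca[of "x / m"] m(1) by simp
  define l where "l = c 1"
  have l0: "l \<noteq> 0" using injc c0 unfolding l_def by (metis injD zero_neq_one)
  define \<sigma> where "\<sigma> x = c x / l" for x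
  have c\<sigma>: "c x = l * \<sigma> x" for x using l0 by (simp add: \<sigma>_def)
  have \<sigma>1: "\<sigma> 1 = 1" using l0 by (simp add: \<sigma>_def l_def)
  have \<sigma>add: "\<sigma> (x + y) = \<sigma> x + \<sigma> y" for x y by (simp add: \<sigma>_def add add_divide_distrib)
  have \<sigma>0: "\<sigma> 0 = 0" by (simp add: \<sigma>_def c0)
  \<comment> \<open>The factors for which \<open>\<sigma>\<close> is multiplicative. A single good
    line of slope \<open>s * m\<close> already puts \<open>s\<close> into \<open>K\<close>.\<close>
  define K where "K = {s. \<forall>z. \<sigma> (s * z) = \<sigma> s * \<sigma> z}"
  have K_add: "s + t \<in> K" if "s \<in> K" "t \<in> K" for s t
    using that by (simp add: K_def \<sigma>add algebra_simps)
  have K_good: "s \<in> K" if g: "good_line a c (s * m) b" for s b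
  proof -
    obtain n where n: "\<And>x. c (s * m * x + b) = n * a x + c b"
      using g by (auto simp: good_line_def)
    have "\<sigma> (s * z) = (n / m') * \<sigma> z" for z
    proof -
      have "c (s * z) = n * a (z / m)" using n[of "z / m"] m(1) by (simp add: add)
      moreover have "c z = m' * a (z / m)" using ca[of "z / m"] m(1) by simp
      ultimately show ?thesis using m'0 by (simp add: \<sigma>_def)
    qed
    moreover from this[of 1] have "\<sigma> s = n / m'" using \<sigma>1 by simp
    ultimately show ?thesis by (simp add: K_def)
  qed
  have K_unique: "s = t" if st: "s \<notin> K" "t \<notin> K" for s t
  proof (rule ccontr)
    assume ne: "s \<noteq> t"
    have K0: "0 \<in> K" by (simp add: K_def \<sigma>0)
    \<comment> \<open>Each of the two slopes is nonzero because \<open>0 \<in> K\<close>, and is bad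
      for all q intercepts; together this reaches the forbidden 2q.\<close>
    have "{s * m, t * m} \<times> UNIV \<subseteq> N" using st K0 K_good m(1) by (auto simp: N_def)
    then have "card ({s * m, t * m} \<times> (UNIV :: 'a set)) \<le> card N" by (intro card_mono) auto
    moreover have "card {s * m, t * m} = 2" using ne m(1) by simp
    ultimately show False using few by (simp add: card_cartesian_product N_def)
  qed
  have K: "s \<in> K" for s
  proof (rule ccontr)
    assume s: "s \<notin> K"
    have "card {0, s} \<le> 2" by (simp add: card_insert_if)
    then have "{0, s} \<noteq> UNIV" using q by (metis not_less_eq_eq numeral_2_eq_2 numeral_3_eq_3 le_trans)
    \<comment> \<open>Splitting \<open>s\<close> as \<open>t + (s - t)\<close> with both summands
      different from \<open>s\<close> puts both, and hence \<open>s\<close>, into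
      \<open>K\<close>.\<close>
    then obtain t where t: "t \<noteq> 0" "t \<noteq> s" by blast
    then have "s - t \<noteq> s" by simp
    then have "t \<in> K" "s - t \<in> K" using K_unique s t(2) by metis+
    then have "t + (s - t) \<in> K" by (rule K_add)
    then show False using s by simp
  qed
  have "inj \<sigma>" using injc l0 by (auto intro!: injI simp: \<sigma>_def inj_eq)
  then have "bij \<sigma>" by (simp add: finite_UNIV_inj_surj bij_def)
  show thesis
  proof (rule that)
    show "field_automorphism \<sigma>"
      using \<open>bij \<sigma>\<close> \<sigma>1 \<sigma>add K by (auto simp: field_automorphism_def K_def)
    show "c x = l * \<sigma> x" for x by (rule c\<sigma>)
    have "l * (\<sigma> m * \<sigma> x) = m' * a x" for x
      using ca[of x] c\<sigma>[of "m * x"] K[of m] by (simp add: K_def)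
    from this[symmetric] show "a x = (l * \<sigma> m / m') * \<sigma> x" for x
      using m'0 by (simp add: eq_divide_eq ac_simps)
  qed
qed

subsection \<open>The coaffinity bound\<close>

theorem theorem8p1:
  fixes f :: "'a::{field,finite} ^ 2 \<Rightarrow> 'a ^ 2"
  assumes "CARD('a) \<ge> 4"
    and "bij f"
    and "f \<notin> AGammaL"
  shows "one_coaffinity f \<ge> 2 * CARD('a)"
proof (rule ccontr)
  assume "\<not> ?thesis"
  then have few: "one_coaffinity f < 2 * CARD('a)" by simp
  have inj: "inj f" using assms(2) by (simp add: bij_def)
  obtain d1 d2 where d: "cross2 d1 d2 \<noteq> 0"
    and "\<And>p. is_line (f ` line_through p d1)" "\<And>p. is_line (f ` line_through p d2)"
    using two_good_directions[OF assms(2) few] by blast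
  moreover have d0: "d1 \<noteq> 0" "d2 \<noteq> 0" using d by (auto simp: cross2_def)
  ultimately obtain e1 e2
    where e0: "e1 \<noteq> 0" "e2 \<noteq> 0"
      and e1: "\<And>p. f ` line_through p d1 = line_through (f p) e1"
      and e2: "\<And>p. f ` line_through p d2 = line_through (f p) e2"
    using parallel_class_image[OF assms(2)] by metis
  have e: "cross2 e1 e2 \<noteq> 0"
  proof
    assume "cross2 e1 e2 = 0"
    then have "line_through (f 0) e1 = line_through (f 0) e2"
      using e0 cross2_eq_0D line_through_scale by metis
    then have "line_through 0 d1 = line_through 0 d2"
      using e1 e2 inj by (metis inj_image_eq_iff)
    then show False using line_through_direction_unique d d0 by blast
  qed
  have step1: "\<exists>t. f (p + x *s d1) = f p + t *s e1" for p x
    using e1[of p] unfolding line_through_def by blast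
  have step2: "\<exists>t. f (p + x *s d2) = f p + t *s e2" for p x
    using e2[of p] unfolding line_through_def by blast
  obtain a where a: "\<And>x. f (x *s d1) = f 0 + a x *s e1" using step1[of 0] by (metis add_0)
  obtain c where c: "\<And>x. f (x *s d2) = f 0 + c x *s e2" using step2[of 0] by (metis add_0)
  \<comment> \<open>The image point is reached along either coordinate direction; comparing the two
    expressions in the basis \<open>e1\<close>, \<open>e2\<close> fixes both coordinates.\<close>
  have fac: "f (x *s d1 + y *s d2) = f 0 + a x *s e1 + c y *s e2" for x y
  proof -
    obtain s where s: "f (x *s d1 + y *s d2) = f 0 + a x *s e1 + s *s e2"
      using step2[of "x *s d1" y] a by metis
    obtain t where t: "f (x *s d1 + y *s d2) = f 0 + c y *s e2 + t *s e1"
      using step1[of "y *s d2" x] c by (metis add.commute)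
    have "a x *s e1 + s *s e2 = t *s e1 + c y *s e2"
      using s t by (simp add: algebra_simps)
    then show ?thesis using s cross2_unique[OF e] by metis
  qed
  have "inj a" "inj c"
    using a c inj d0 by (auto intro!: injI) (metis injD vec.scale_right_imp_eq)+
  then have bij: "bij a" "bij c" by (simp_all add: finite_UNIV_inj_surj bij_def)
  have zero: "a 0 = 0" "c 0 = 0" using a[of 0] c[of 0] e0 by simp_all
  \<comment> \<open>The line y = m x + b in the coordinates given by \<open>d1\<close> and
    \<open>d2\<close>.\<close>
  define l where "l = (\<lambda>(m, b). line_through (b *s d2) (d1 + m *s d2))"
  have nz: "d1 + m *s d2 \<noteq> 0" for m
    using cross2_unique[OF d, of 1 m 0 0] by auto
  have l_mem: "x *s d1 + y *s d2 \<in> l (m, b) \<longleftrightarrow> y = m * x + b" for x y m b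
  proof -
    have *: "b *s d2 + t *s (d1 + m *s d2) = t *s d1 + (m * t + b) *s d2" for t
      by (simp add: algebra_simps vec.scale_left_distrib vec.scale_right_distrib)
    show ?thesis unfolding l_def line_through_def
      using cross2_unique[OF d] by (auto simp: *)
  qed
  have good: "good_line a c m b" if line: "is_line (f ` l (m, b))" for m b
  proof -
    obtain p e where pe: "e \<noteq> 0" "f ` l (m, b) = line_through p e"
      using line unfolding is_line_iff by blast
    have in_line: "f 0 + a x *s e1 + c (m * x + b) *s e2 \<in> line_through p e" for x
      using pe(2) l_mem fac by (metis imageI)
    define p' where "p' = f 0 + a 0 *s e1 + c b *s e2"
    have p': "line_through p e = line_through p' e"
      using line_through_eq in_line[of 0] by (simp add: p'_def)
    define r s where "r = cross2 e e2 / cross2 e1 e2" and "s = cross2 e1 e / cross2 e1 e2"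
    have ers: "e = r *s e1 + s *s e2" unfolding r_def s_def by (rule cross2_decomp[OF e])
    have ex: "\<exists>t. a x = t * r \<and> c (m * x + b) = c b + t * s" for x
    proof -
      obtain t where "f 0 + a x *s e1 + c (m * x + b) *s e2 = p' + t *s e"
        using in_line[of x] p' by (auto simp: line_through_def)
      then have "a x *s e1 + c (m * x + b) *s e2 = (t * r) *s e1 + (c b + t * s) *s e2"
        by (simp add: p'_def ers zero algebra_simps vec.scale_left_distrib vec.scale_right_distrib)
      then show ?thesis using cross2_unique[OF e] by blast
    qed
    \<comment> \<open>The image line is not parallel to \<open>e2\<close>, since \<open>a\<close>
      takes different values at 0 and 1; its slope is therefore \<open>s / r\<close>.\<close>
    have "r \<noteq> 0" using ex[of 1] zero(1) \<open>inj a\<close> by (metis injD mult_zero_right zero_neq_one)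
    have "c (m * x + b) = (s / r) * a x + c b" for x
      using ex[of x] \<open>r \<noteq> 0\<close> by auto
    then show ?thesis unfolding good_line_def by blast
  qed
  have inj_l: "inj l"
  proof (rule injI, clarify)
    fix m b n b' assume *: "l (m, b) = l (n, b')"
    have "m * x + b = n * x + b'" for x using l_mem * by metis
    from this[of 0] this[of 1] show "m = n \<and> b = b'" by simp
  qed
  \<comment> \<open>Pairs violating \<open>good_line\<close> inject into the bad lines, so the
    coaffinity bound carries over to pairs.\<close>
  have "l ` {(m, b). m \<noteq> 0 \<and> \<not> good_line a c m b} \<subseteq> {L. is_line L \<and> \<not> is_line (f ` L)}"
  proof clarify
    fix m b assume "\<not> good_line a c m b"
    then have "\<not> is_line (f ` l (m, b))" using good by blast
    moreover have "is_line (l (m, b))" unfolding is_line_iff l_def using nz by blast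
    ultimately show "is_line (l (m, b)) \<and> \<not> is_line (f ` l (m, b))" by blast
  qed
  then have "card {(m, b). m \<noteq> 0 \<and> \<not> good_line a c m b} \<le> one_coaffinity f"
    unfolding one_coaffinity_def
    using inj_on_subset[OF inj_l] by (intro card_inj_on_le[where f = l]) auto
  then have "card {(m, b). m \<noteq> 0 \<and> \<not> good_line a c m b} < 2 * CARD('a)" using few by simp
  moreover have "CARD('a) \<ge> 3" using assms(1) by simp
  ultimately obtain \<sigma> k h where \<sigma>: "field_automorphism \<sigma>"
    and ak: "\<And>x. a x = k * \<sigma> x" and ch: "\<And>x. c x = h * \<sigma> x"
    using separated_semilinear[OF bij(1) zero(1) bij(2) _ _ zero(2)] by metis
  have hom: "\<sigma> (x + y) = \<sigma> x + \<sigma> y" "\<sigma> (x * y) = \<sigma> x * \<sigma> y" for x y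
    using \<sigma> by (auto simp: field_automorphism_def)
  \<comment> \<open>The candidate for the semilinear part, with translation vector
    \<open>f 0\<close>.\<close>
  define g where "g = (\<lambda>v. f v - f 0)"
  have g: "g (x *s d1 + y *s d2) = (k * \<sigma> x) *s e1 + (h * \<sigma> y) *s e2" for x y
    by (simp add: g_def fac ak ch)
  have coord: "\<exists>x y. v = x *s d1 + y *s d2" for v using cross2_decomp[OF d] by blast
  have "bij g" unfolding g_def
    using bij_comp[OF assms(2) bij_diff_right] by (simp add: comp_def)
  moreover have "g (v + w) = g v + g w" for v w
  proof -
    obtain x y x' y' where vw: "v = x *s d1 + y *s d2" "w = x' *s d1 + y' *s d2"
      using coord by metis
    then have "v + w = (x + x') *s d1 + (y + y') *s d2"
      by (simp add: algebra_simps vec.scale_left_distrib)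
    then show ?thesis by (simp only: g vw hom) (simp add: algebra_simps vec.scale_left_distrib)
  qed
  moreover have "g (\<alpha> *s v) = \<sigma> \<alpha> *s g v" for \<alpha> v
  proof -
    obtain x y where v: "v = x *s d1 + y *s d2" using coord by metis
    then have "\<alpha> *s v = (\<alpha> * x) *s d1 + (\<alpha> * y) *s d2"
      by (simp add: vec.scale_right_distrib)
    then show ?thesis by (simp only: g v hom) (simp add: vec.scale_right_distrib mult.left_commute)
  qed
  moreover have "f = (\<lambda>x. g x + f 0)" by (simp add: g_def)
  ultimately have "f \<in> AGammaL" unfolding AGammaL_def using \<sigma> by blast
  then show False using assms(3) by blast
qed

end
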